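(* Let $G=(V,E)$ be a primitive strongly regular graph with parameters $(v,k,\lambda,\mu)$, and let $k>\theta_1>\theta_2$ be the distinct eigenvalues of its $(0,1)$ adjacency matrix. Let $H$ be a subset of $V$ of cardinality $h$, and let $S(G,H)$ be the graph obtained from $G$ by switching with respect to $H$. Suppose $v=2(k-\theta_1)$. Then the following are equivalent: (i) $S(G,H)$ is a strongly regular graph with parameters $(v,k,\lambda,\mu)$; (ii) the subgraph of $G$ induced by $H$ is $\left(k-\frac{v-h}{2}\right)$-regular.
   Context: A simple graph is strongly regular with parameters $(v,k,\lambda,\mu)$ if it has $v$ vertices, is $k$-regular, any two adjacent vertices have exactly $\lambda$ common neighbours, and any two distinct nonadjacent vertices have exactly $\mu$ common neighbours. It is primitive if both it and its complement are connected. The $(0,1)$ adjacency matrix has $(x,y)$ entry $1$ if $x,y$ are adjacent and $0$ otherwise. For $H\subseteq V$, the switched graph $S(G,H)$ has vertex set $V$; for $x,y$ both in $H$ or both in $V\setminus H$ adjacency is as in $G$, while for $x\in H$, $y\in V\setminus H$ the pair $x,y$ is adjacent in $S(G,H)$ if and only if it is not adjacent in $G$. *)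

theory Defs
  imports
    Complex_Main
    "Graph_Theory.Pair_Digraph"
    "Graph_Theory.Digraph_Component"
    "Jordan_Normal_Form.Char_Poly"
begin

text \<open>Finite simple graphs are the loopless symmetric digraphs without parallel arcs of
  the locale \<^locale>\<open>pair_graph\<close>; an edge \<open>{x, y}\<close> is the pair of arcs \<open>(x, y)\<close>, \<open>(y, x)\<close>.\<close>

text \<open>In a simple graph the out-degree is the number of neighbours. The degree \<open>d\<close> is
  real, since it may be given by an expression that is not a natural number; the graph without
  vertices is \<open>d\<close>-regular for every \<open>d\<close>.\<close>
definition regular :: "('a, 'b) pre_digraph \<Rightarrow> real \<Rightarrow> bool" where
  "regular G d \<longleftrightarrow> (\<forall>x\<in>verts G. real (out_degree G x) = d)"

definition common_neighbours :: "'a pair_pre_digraph \<Rightarrow> 'a \<Rightarrow> 'a \<Rightarrow> 'a set" where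
  "common_neighbours G x y = {z \<in> pverts G. (x, z) \<in> parcs G \<and> (y, z) \<in> parcs G}"

definition strongly_regular :: "'a pair_pre_digraph \<Rightarrow> nat \<Rightarrow> nat \<Rightarrow> nat \<Rightarrow> nat \<Rightarrow> bool" where
  "strongly_regular G v k l m \<longleftrightarrow>
     pair_graph G \<and>
     card (pverts G) = v \<and>
     regular (with_proj G) (real k) \<and>
     (\<forall>x\<in>pverts G. \<forall>y\<in>pverts G. (x, y) \<in> parcs G \<longrightarrow> card (common_neighbours G x y) = l) \<and>
     (\<forall>x\<in>pverts G. \<forall>y\<in>pverts G. x \<noteq> y \<and> (x, y) \<notin> parcs G \<longrightarrow>
        card (common_neighbours G x y) = m)"

definition complement :: "'a pair_pre_digraph \<Rightarrow> 'a pair_pre_digraph" where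
  "complement G =
     \<lparr> pverts = pverts G,
       parcs = {(x, y). x \<in> pverts G \<and> y \<in> pverts G \<and> x \<noteq> y \<and> (x, y) \<notin> parcs G} \<rparr>"

text \<open>The qualified name avoids the topological notion of connectedness.\<close>
definition primitive :: "'a pair_pre_digraph \<Rightarrow> bool" where
  "primitive G \<longleftrightarrow>
     Digraph_Component.connected (with_proj G) \<and>
     Digraph_Component.connected (with_proj (complement G))"

text \<open>The matrix type is indexed by numbers, so the rows and columns are labelled by a list
  \<open>xs\<close> enumerating the vertices. Another enumeration gives a matrix that is similar by a
  permutation, with the same eigenvalues.\<close>
definition adjacency_matrix :: "'a pair_pre_digraph \<Rightarrow> 'a list \<Rightarrow> real mat" where
  "adjacency_matrix G xs =
     mat (length xs) (length xs) (\<lambda>(i, j). if (xs ! i, xs ! j) \<in> parcs G then 1 else 0)"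

definition switching :: "'a pair_pre_digraph \<Rightarrow> 'a set \<Rightarrow> 'a pair_pre_digraph" where
  "switching G H =
     \<lparr> pverts = pverts G,
       parcs = {(x, y). x \<in> pverts G \<and> y \<in> pverts G \<and>
                  (if x \<in> H \<longleftrightarrow> y \<in> H then (x, y) \<in> parcs G else (x, y) \<notin> parcs G)} \<rparr>"

end

theory Submission
  imports Defs
begin

text \<open>That (i) implies (ii) is a degree count at the vertices of \<open>H\<close>. Conversely, on the orthogonal
  complement of the all-ones vector the adjacency matrix \<open>A\<close> satisfies
  \<open>(A - \<theta>\<^sub>1 I) (A - \<theta>\<^sub>2 I) = 0\<close>, and the condition \<open>v = 2 (k - \<theta>\<^sub>1)\<close> makes (ii) the equality case
  of the bound \<open>A \<le> \<theta>\<^sub>1\<close> for the projection of the indicator vector of \<open>H\<close>. So this projection is an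
  eigenvector, and every vertex outside \<open>H\<close> has exactly \<open>h/2\<close> neighbours in \<open>H\<close>. It follows that
  switching preserves all degrees, preserves the number of common neighbours of two vertices on
  the same side, and replaces it by \<open>\<lambda> + \<mu>\<close> minus itself for vertices on different sides, where
  adjacency is complemented as well.\<close>

section \<open>Counting neighbours by sums of adjacency entries\<close>

text \<open>Real-valued entries of the adjacency matrix \<open>A\<close>, indexed by vertices, so
  that counts become sums and matrix identities need no enumeration of the vertices.\<close>

definition adj :: "'a pair_pre_digraph \<Rightarrow> 'a \<Rightarrow> 'a \<Rightarrow> real" where
  "adj G x y = of_bool ((x, y) \<in> parcs G)"

lemma adj_idem: "adj G x y * adj G x y = adj G x y"
  by (simp add: adj_def)

lemma adj_sym:
  assumes "pair_graph G"
  shows "adj G x y = adj G y x"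
proof -
  interpret pair_graph G by fact
  show ?thesis
    using arcs_symmetric by (auto simp: adj_def)
qed

lemma finite_pverts:
  assumes "pair_graph G"
  shows "finite (pverts G)"
proof -
  interpret pair_graph G by fact
  show ?thesis by (rule pair_finite_verts)
qed

lemma out_degree_induce:
  assumes "pair_graph G" "H \<subseteq> pverts G" "x \<in> H"
  shows "real (out_degree (with_proj G \<restriction> H) x) = (\<Sum>y\<in>H. adj G x y)"
proof -
  have "finite H"
    using assms finite_pverts finite_subset by blast
  have "out_arcs (with_proj G \<restriction> H) x = Pair x ` {y \<in> H. (x, y) \<in> parcs G}"
    using assms by (auto simp: out_arcs_def induce_subgraph_def)
  then have "out_degree (with_proj G \<restriction> H) x = card {y \<in> H. (x, y) \<in> parcs G}"
    by (simp add: out_degree_def card_image inj_on_def)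
  then show ?thesis
    using \<open>finite H\<close> by (simp add: adj_def Int_def)
qed

lemma out_degree_eq_sum:
  assumes "pair_graph G" "x \<in> pverts G"
  shows "real (out_degree (with_proj G) x) = (\<Sum>y\<in>pverts G. adj G x y)"
proof -
  interpret pair_graph G by fact
  have "out_arcs (with_proj G) x = Pair x ` {y \<in> pverts G. (x, y) \<in> parcs G}"
    by (auto simp: out_arcs_def dest: in_arcsD2)
  then have "out_degree (with_proj G) x = card {y \<in> pverts G. (x, y) \<in> parcs G}"
    by (simp add: out_degree_def card_image inj_on_def)
  then show ?thesis
    by (simp add: adj_def Int_def finite_pverts assms)
qed

lemma card_common_neighbours:
  assumes "pair_graph G"
  shows "real (card (common_neighbours G x y)) = (\<Sum>z\<in>pverts G. adj G x z * adj G y z)"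
  by (simp add: adj_def common_neighbours_def Int_def finite_pverts assms
      flip: of_bool_conj)

lemma regular_iff:
  assumes "pair_graph G"
  shows "regular (with_proj G) d \<longleftrightarrow> (\<forall>x\<in>pverts G. (\<Sum>y\<in>pverts G. adj G x y) = d)"
  using assms by (simp add: regular_def out_degree_eq_sum)

text \<open>The adjacent and the nonadjacent case merge into one affine formula in
  \<open>adj G x y\<close>, the off-diagonal part of
  \<open>A^2 = (k - m) I + (l - m) A + m J\<close>. Looplessness makes adjacent vertices distinct,
  so the restriction to \<open>x \<noteq> y\<close> loses nothing.\<close>

lemma strongly_regular_iff:
  "strongly_regular G v k l m \<longleftrightarrow>
     pair_graph G \<and> card (pverts G) = v \<and>
     (\<forall>x\<in>pverts G. (\<Sum>y\<in>pverts G. adj G x y) = k) \<and>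
     (\<forall>x\<in>pverts G. \<forall>y\<in>pverts G. x \<noteq> y \<longrightarrow>
        (\<Sum>z\<in>pverts G. adj G x z * adj G y z) = (real l - m) * adj G x y + m)"
proof (cases "pair_graph G")
  case True
  then interpret pair_graph G .
  have noloop: "x \<noteq> y" if "(x, y) \<in> parcs G" for x y
    using pair_no_loops[OF that] by simp
  have "((\<Sum>z\<in>pverts G. adj G x z * adj G y z) = (real l - m) * adj G x y + m) \<longleftrightarrow>
      card (common_neighbours G x y) = (if (x, y) \<in> parcs G then l else m)" for x y
    unfolding card_common_neighbours[OF True, symmetric] by (simp add: adj_def)
  then show ?thesis
    unfolding strongly_regular_def regular_iff[OF True] using True noloop by auto
qed (simp add: strongly_regular_def)

section \<open>Eigenvectors as functions on the vertices\<close>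

lemma eigenvalue_adjacency_matrixE:
  assumes "eigenvalue (adjacency_matrix G xs) \<theta>" "distinct xs" "set xs = pverts G"
  obtains f where "\<And>x. x \<in> pverts G \<Longrightarrow> (\<Sum>y\<in>pverts G. adj G x y * f y) = \<theta> * f x"
    and "\<exists>x\<in>pverts G. f x \<noteq> 0"
proof -
  let ?n = "length xs"
  obtain w where w: "w \<in> carrier_vec ?n" "w \<noteq> 0\<^sub>v ?n"
    "adjacency_matrix G xs *\<^sub>v w = \<theta> \<cdot>\<^sub>v w"
    using assms(1) by (auto simp: eigenvalue_def eigenvector_def adjacency_matrix_def)
  have bij: "bij_betw ((!) xs) {..<?n} (pverts G)"
    using bij_betw_nth assms by blast
  \<comment> \<open>The entry of \<open>w\<close> at the position of \<open>x\<close> in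
    \<open>xs\<close>, well defined because the list is distinct.\<close>
  define f where "f x = w $ inv_into {..<?n} ((!) xs) x" for x
  have f: "f (xs ! i) = w $ i" if "i < ?n" for i
    unfolding f_def using bij_betw_inv_into_left[OF bij] that by simp
  have eq: "(\<Sum>y\<in>pverts G. adj G (xs ! i) y * f y) = \<theta> * f (xs ! i)" if "i < ?n" for i
  proof -
    have "(\<Sum>y\<in>pverts G. adj G (xs ! i) y * f y) = (\<Sum>j<?n. adj G (xs ! i) (xs ! j) * w $ j)"
      using f by (simp add: sum.reindex_bij_betw[OF bij, symmetric])
    also have "\<dots> = (adjacency_matrix G xs *\<^sub>v w) $ i"
      using that w(1)
      by (simp add: adjacency_matrix_def scalar_prod_def adj_def of_bool_def atLeast0LessThan)
    also have "\<dots> = \<theta> * f (xs ! i)"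
      using that w f by simp
    finally show ?thesis .
  qed
  obtain i where "i < ?n" "w $ i \<noteq> 0"
    using w(1,2) by (metis carrier_vecD eq_vecI index_zero_vec)
  show thesis
  proof (rule that)
    show "(\<Sum>y\<in>pverts G. adj G x y * f y) = \<theta> * f x" if "x \<in> pverts G" for x
      using eq that assms(3) by (metis in_set_conv_nth)
    show "\<exists>x\<in>pverts G. f x \<noteq> 0"
      using f \<open>i < ?n\<close> \<open>w $ i \<noteq> 0\<close> assms(3) by (metis nth_mem)
  qed
qed

section \<open>Degrees and common neighbours after switching\<close>

lemma pair_graph_switching:
  assumes "pair_graph G"
  shows "pair_graph (switching G H)"
proof -
  interpret pair_graph G by fact
  have fin: "finite (parcs (switching G H))"
    by (rule finite_subset[of _ "pverts G \<times> pverts G"]) (auto simp: switching_def)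
  have "sym (parcs (switching G H))"
    using arcs_symmetric by (auto simp: switching_def sym_def split: if_splits)
  then show ?thesis
    using fin pair_finite_verts no_loops
    by unfold_locales (auto simp: switching_def symmetric_def split: if_splits)
qed

text \<open>Switching conjugates \<open>A - J/2\<close> by the diagonal sign matrix of \<open>H\<close>.\<close>
lemma adj_switching:
  assumes "x \<in> pverts G" "y \<in> pverts G"
  shows "adj (switching G H) x y =
    1/2 + (1 - 2 * of_bool (x \<in> H)) * (1 - 2 * of_bool (y \<in> H)) * (adj G x y - 1/2)"
  using assms by (simp add: adj_def switching_def of_bool_def)

lemma sum_of_bool_mult:
  fixes f :: "'a \<Rightarrow> real"
  assumes "finite V" "H \<subseteq> V"
  shows "(\<Sum>x\<in>V. of_bool (x \<in> H) * f x) = sum f H"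
proof -
  have "(\<Sum>x\<in>V. of_bool (x \<in> H) * f x) = (\<Sum>x\<in>V. if x \<in> H then f x else 0)"
    by (intro sum.cong) auto
  also have "\<dots> = sum f H"
    using assms by (simp add: sum.If_cases Int_absorb1)
  finally show ?thesis .
qed

text \<open>This holds for every \<open>H\<close>, so it serves both implications: solved for the
  sum over \<open>H\<close> in one, evaluated with a known sum in the other.\<close>

lemma degree_switching:
  assumes "finite (pverts G)" "H \<subseteq> pverts G" "x \<in> pverts G"
  shows "(\<Sum>y\<in>pverts G. adj (switching G H) x y) = card (pverts G) / 2 +
    (1 - 2 * of_bool (x \<in> H)) * ((\<Sum>y\<in>pverts G. adj G x y) - 2 * (\<Sum>y\<in>H. adj G x y)
      - card (pverts G) / 2 + card H)"
proof -
  let ?s = "\<lambda>x. 1 - 2 * of_bool (x \<in> H) :: real"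
  have "(\<Sum>y\<in>pverts G. adj (switching G H) x y) =
      (\<Sum>y\<in>pverts G. 1/2 + ?s x * (adj G x y - 2 * (of_bool (y \<in> H) * adj G x y)
        - 1/2 + of_bool (y \<in> H) * 1))"
    using assms(3) by (intro sum.cong) (auto simp: adj_switching)
  also have "\<dots> = card (pverts G) / 2 + ?s x * ((\<Sum>y\<in>pverts G. adj G x y)
      - 2 * (\<Sum>y\<in>H. adj G x y) - card (pverts G) / 2 + card H)"
    unfolding sum.distrib sum_subtractf sum_distrib_left[symmetric] sum_of_bool_mult[OF assms(1,2)]
    by simp
  finally show ?thesis .
qed

text \<open>Put \<open>M = A - J/2\<close> and let \<open>D\<close> be the diagonal matrix of the
  signs \<open>?s\<close>. The switched matrix is \<open>J/2 + D M D\<close>, and its square is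
  expanded into the term from \<open>J\<close>, two cross terms and \<open>D M^2 D\<close>.\<close>

lemma common_neighbours_switching:
  assumes "finite (pverts G)" "H \<subseteq> pverts G" "x \<in> pverts G" "y \<in> pverts G"
    and deg: "\<And>x. x \<in> pverts G \<Longrightarrow> (\<Sum>y\<in>pverts G. adj G x y) = k"
    and nbr: "\<And>x. x \<in> pverts G \<Longrightarrow> (\<Sum>y\<in>H. adj G x y) = \<theta> * of_bool (x \<in> H) + card H / 2"
    and v: "real (card (pverts G)) = 2 * (k - \<theta>)"
  shows "(\<Sum>z\<in>pverts G. adj (switching G H) x z * adj (switching G H) y z) =
    card (pverts G) / 4 + \<theta> + (1 - 2 * of_bool (x \<in> H)) * (1 - 2 * of_bool (y \<in> H)) *
      ((\<Sum>z\<in>pverts G. adj G x z * adj G y z) - k + card (pverts G) / 4)"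
proof -
  let ?s = "\<lambda>x. 1 - 2 * of_bool (x \<in> H) :: real"
  \<comment> \<open>The sign vector is an eigenvector of \<open>A - J/2\<close> for
    \<open>\<theta>\<close>; this evaluates the cross terms.\<close>
  have signed: "(\<Sum>z\<in>pverts G. ?s z * (adj G x z - 1/2)) = \<theta> * ?s x" if "x \<in> pverts G" for x
  proof -
    have "(\<Sum>z\<in>pverts G. ?s z * (adj G x z - 1/2)) =
        (\<Sum>z\<in>pverts G. adj G x z - 2 * (of_bool (z \<in> H) * adj G x z) - 1/2 + of_bool (z \<in> H) * 1)"
      by (intro sum.cong) (auto simp: algebra_simps)
    also have "\<dots> = k - 2 * (\<theta> * of_bool (x \<in> H) + card H / 2) - card (pverts G) / 2 + card H"
      unfolding sum.distrib sum_subtractf sum_distrib_left[symmetric]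
        sum_of_bool_mult[OF assms(1,2)] deg[OF that] nbr[OF that]
      by simp
    also have "\<dots> = \<theta> * ?s x"
      by (simp add: v field_simps)
    finally show ?thesis .
  qed
  have "(\<Sum>z\<in>pverts G. adj (switching G H) x z * adj (switching G H) y z) =
      (\<Sum>z\<in>pverts G. 1/4 + ?s x/2 * (?s z * (adj G x z - 1/2)) + ?s y/2 * (?s z * (adj G y z - 1/2))
        + ?s x * ?s y * (adj G x z * adj G y z - 1/2 * adj G x z - 1/2 * adj G y z + 1/4))"
    using assms(3,4) by (intro sum.cong refl) (auto simp: adj_switching field_simps)
  also have "\<dots> = card (pverts G) / 4 + ?s x/2 * (\<theta> * ?s x) + ?s y/2 * (\<theta> * ?s y)
      + ?s x * ?s y * ((\<Sum>z\<in>pverts G. adj G x z * adj G y z) - 1/2 * k - 1/2 * k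
          + card (pverts G) / 4)"
    unfolding sum.distrib sum_subtractf sum_distrib_left[symmetric] signed[OF assms(3)]
      signed[OF assms(4)] deg[OF assms(3)] deg[OF assms(4)]
    by simp
  \<comment> \<open>Signs square to 1, so each cross term equals
    \<open>\<theta> / 2\<close>.\<close>
  also have "\<dots> = card (pverts G) / 4 + \<theta> + ?s x * ?s y *
      ((\<Sum>z\<in>pverts G. adj G x z * adj G y z) - k + card (pverts G) / 4)"
    by simp
  finally show ?thesis .
qed

section \<open>The quadratic equation of a strongly regular graph\<close>

text \<open>The full identity \<open>A^2 = (k - m) I + (l - m) A + m J\<close>: since entries are 0
  or 1, a diagonal entry of \<open>A^2\<close> is the degree \<open>k\<close>.\<close>

lemma sum_adj_square:
  assumes "strongly_regular G v k l m" "x \<in> pverts G" "y \<in> pverts G"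
  shows "(\<Sum>z\<in>pverts G. adj G z x * adj G z y) =
    (real k - m) * of_bool (x = y) + (real l - m) * adj G x y + m"
proof -
  have pg: "pair_graph G"
    using assms(1) by (simp add: strongly_regular_def)
  interpret pair_graph G by fact
  have *: "(\<Sum>z\<in>pverts G. adj G z x * adj G z y) = (\<Sum>z\<in>pverts G. adj G x z * adj G y z)"
    using adj_sym[OF pg] by (intro sum.cong) auto
  show ?thesis
  proof (cases "x = y")
    case True
    have "(y, y) \<notin> parcs G"
      using pair_no_loops[of "(y, y)"] by auto
    then have "adj G y y = 0"
      by (simp add: adj_def)
    then show ?thesis
      unfolding * using True assms by (simp add: adj_idem strongly_regular_iff)
  next
    case False
    then show ?thesis
      unfolding * using assms by (simp add: strongly_regular_iff)
  qed
qed

lemma sum_square_adj_apply: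
  assumes srg: "strongly_regular G v k l m" and x: "x \<in> pverts G"
  shows "(\<Sum>z\<in>pverts G. adj G x z * (\<Sum>y\<in>pverts G. adj G z y * f y)) =
    (real k - m) * f x + (real l - m) * (\<Sum>y\<in>pverts G. adj G x y * f y) + m * sum f (pverts G)"
proof -
  have pg: "pair_graph G"
    using srg by (simp add: strongly_regular_def)
  have "(\<Sum>z\<in>pverts G. adj G x z * (\<Sum>y\<in>pverts G. adj G z y * f y)) =
      (\<Sum>y\<in>pverts G. (\<Sum>z\<in>pverts G. adj G z x * adj G z y) * f y)"
    unfolding sum_distrib_left sum_distrib_right
    by (subst sum.swap) (simp add: adj_sym[OF pg, of x] mult.assoc)
  also have "\<dots> = (\<Sum>y\<in>pverts G. (real k - m) * (if x = y then f y else 0)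
      + (real l - m) * (adj G x y * f y) + m * f y)"
    by (intro sum.cong refl, subst sum_adj_square[OF srg x]) (auto simp: algebra_simps)
  also have "\<dots> = (real k - m) * f x + (real l - m) * (\<Sum>y\<in>pverts G. adj G x y * f y)
      + m * sum f (pverts G)"
    using x finite_pverts[OF pg] by (simp add: sum.distrib sum_distrib_left[symmetric])
  finally show ?thesis .
qed

text \<open>An eigenvector for \<open>\<theta> \<noteq> k\<close> is orthogonal to the all-ones
  vector, so the \<open>J\<close> term of the identity for \<open>A^2\<close> vanishes on
  it.\<close>

lemma eigenvalue_quadratic:
  assumes srg: "strongly_regular G v k l m" and xs: "distinct xs" "set xs = pverts G"
    and ev: "eigenvalue (adjacency_matrix G xs) \<theta>" and "\<theta> \<noteq> k"
  shows "\<theta>\<^sup>2 = (real k - m) + (real l - m) * \<theta>"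
proof -
  have pg: "pair_graph G" and deg: "\<And>x. x \<in> pverts G \<Longrightarrow> (\<Sum>y\<in>pverts G. adj G x y) = k"
    using srg by (auto simp: strongly_regular_iff)
  obtain f x where f: "\<And>x. x \<in> pverts G \<Longrightarrow> (\<Sum>y\<in>pverts G. adj G x y * f y) = \<theta> * f x"
    and x: "x \<in> pverts G" "f x \<noteq> 0"
    using eigenvalue_adjacency_matrixE[OF ev xs] by metis
  \<comment> \<open>Pairing \<open>A f\<close> with the all-ones vector in two ways: by the
    eigenvalue equation, and by symmetry and regularity.\<close>
  have "\<theta> * sum f (pverts G) = (\<Sum>x\<in>pverts G. \<Sum>y\<in>pverts G. adj G x y * f y)"
    using f by (simp add: sum_distrib_left)
  also have "\<dots> = (\<Sum>y\<in>pverts G. (\<Sum>x\<in>pverts G. adj G y x) * f y)"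
    by (subst sum.swap) (simp add: adj_sym[OF pg] sum_distrib_right)
  also have "\<dots> = k * sum f (pverts G)"
    using deg by (simp add: sum_distrib_left)
  finally have "sum f (pverts G) = 0"
    using \<open>\<theta> \<noteq> k\<close> by simp
  moreover have "(\<Sum>z\<in>pverts G. adj G x z * (\<Sum>y\<in>pverts G. adj G z y * f y)) = \<theta> * (\<theta> * f x)"
  proof -
    have "(\<Sum>z\<in>pverts G. adj G x z * (\<Sum>y\<in>pverts G. adj G z y * f y)) =
        (\<Sum>z\<in>pverts G. \<theta> * (adj G x z * f z))"
      using f by (intro sum.cong) auto
    then show ?thesis
      using f[OF x(1)] by (simp add: sum_distrib_left[symmetric])
  qed
  ultimately have "\<theta> * (\<theta> * f x) = (real k - m) * f x + (real l - m) * (\<theta> * f x)"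
    using sum_square_adj_apply[OF srg x(1), of f] f[OF x(1)] by simp
  then have "(\<theta>\<^sup>2 - ((real k - m) + (real l - m) * \<theta>)) * f x = 0"
    by (simp add: power2_eq_square algebra_simps)
  then show ?thesis
    using x(2) by simp
qed

text \<open>Equality in eigenvalue interlacing for the partition into \<open>H\<close> and its complement: the
  variance of the number of neighbours in \<open>H\<close>, taken over the vertices outside \<open>H\<close>, vanishes.\<close>
lemma neighbours_outside:
  assumes srg: "strongly_regular G v k l m" and H: "H \<subseteq> pverts G"
    and v: "real v = 2 * (k - \<theta>\<^sub>1)"
    and vieta: "real l - m = \<theta>\<^sub>1 + \<theta>\<^sub>2" "real k - m = - \<theta>\<^sub>1 * \<theta>\<^sub>2" "k - \<theta>\<^sub>2 = 2 * m"
    and reg: "\<And>x. x \<in> H \<Longrightarrow> (\<Sum>y\<in>H. adj G x y) = \<theta>\<^sub>1 + card H / 2"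
    and y: "y \<in> pverts G - H"
  shows "(\<Sum>x\<in>H. adj G y x) = card H / 2"
proof -
  let ?n = "\<lambda>y. \<Sum>x\<in>H. adj G y x" and ?h = "real (card H)"
  have pg: "pair_graph G" and deg: "\<And>x. x \<in> pverts G \<Longrightarrow> (\<Sum>y\<in>pverts G. adj G x y) = k"
    and card: "card (pverts G) = v"
    using srg by (auto simp: strongly_regular_iff)
  note fin = finite_pverts[OF pg]
  have finH: "finite H"
    using fin H finite_subset by blast
  have "(\<Sum>y\<in>pverts G. ?n y) = (\<Sum>x\<in>H. \<Sum>y\<in>pverts G. adj G x y)"
    by (subst sum.swap) (simp add: adj_sym[OF pg])
  also have "\<dots> = k * ?h"
    using deg H by (simp add: subset_iff)
  finally have s1: "(\<Sum>y\<in>pverts G. ?n y) = k * ?h" .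
  \<comment> \<open>Second moment of \<open>?n\<close>: moving the sum over \<open>y\<close> inside
    leaves the entries of \<open>A^2\<close> summed over \<open>H \<times> H\<close>.\<close>
  have "(\<Sum>y\<in>pverts G. (?n y)\<^sup>2) = (\<Sum>y\<in>pverts G. \<Sum>x\<in>H. \<Sum>x'\<in>H. adj G y x * adj G y x')"
    by (simp add: power2_eq_square sum_product)
  also have "\<dots> = (\<Sum>x\<in>H. \<Sum>x'\<in>H. \<Sum>y\<in>pverts G. adj G y x * adj G y x')"
    by (subst sum.swap, rule sum.cong[OF refl], rule sum.swap)
  also have "\<dots> = (\<Sum>x\<in>H. \<Sum>x'\<in>H. (real k - m) * of_bool (x = x') + (real l - m) * adj G x x' + m)"
    using H by (intro sum.cong refl sum_adj_square[OF srg]) auto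
  also have "\<dots> = (\<Sum>x\<in>H. (real k - m) + (real l - m) * ?n x + m * ?h)"
  proof (rule sum.cong[OF refl])
    fix x assume "x \<in> H"
    then have "(\<Sum>x'\<in>H. of_bool (x = x') :: real) = 1"
      using finH by (simp add: of_bool_def)
    then show "(\<Sum>x'\<in>H. (real k - m) * of_bool (x = x') + (real l - m) * adj G x x' + m) =
        (real k - m) + (real l - m) * ?n x + m * ?h"
      unfolding sum.distrib sum_distrib_left[symmetric] by simp
  qed
  also have "\<dots> = ?h * ((real k - m) + (real l - m) * (\<theta>\<^sub>1 + ?h / 2) + m * ?h)"
    using reg by simp
  finally have s2: "(\<Sum>y\<in>pverts G. (?n y)\<^sup>2) =
    ?h * ((real k - m) + (real l - m) * (\<theta>\<^sub>1 + ?h / 2) + m * ?h)" .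
  have "(\<Sum>y\<in>pverts G - H. (?n y - ?h / 2)\<^sup>2) =
      (\<Sum>y\<in>pverts G. (?n y - ?h / 2)\<^sup>2) - (\<Sum>y\<in>H. (?n y - ?h / 2)\<^sup>2)"
    using fin H by (simp add: sum_diff)
  \<comment> \<open>On \<open>H\<close> every deviation from \<open>?h / 2\<close> is
    \<open>\<theta>\<^sub>1\<close>.\<close>
  also have "(\<Sum>y\<in>H. (?n y - ?h / 2)\<^sup>2) = ?h * \<theta>\<^sub>1\<^sup>2"
    using reg by simp
  also have "(\<Sum>y\<in>pverts G. (?n y - ?h / 2)\<^sup>2) =
      (\<Sum>y\<in>pverts G. (?n y)\<^sup>2 - ?h * ?n y + ?h\<^sup>2 / 4)"
    by (intro sum.cong) (auto simp: power2_eq_square algebra_simps)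
  also have "\<dots> = (\<Sum>y\<in>pverts G. (?n y)\<^sup>2) - ?h * (\<Sum>y\<in>pverts G. ?n y) + v * (?h\<^sup>2 / 4)"
    unfolding sum.distrib sum_subtractf sum_distrib_left[symmetric] using card by simp
  \<comment> \<open>After eliminating \<open>k - m\<close>, \<open>l - m\<close> and
    \<open>m\<close>, the second moment is
    \<open>h \<theta>\<^sub>1^2 + h^2 (k + \<theta>\<^sub>1) / 2\<close>, and
    \<open>v = 2 (k - \<theta>\<^sub>1)\<close> cancels the terms in \<open>h^2\<close>.\<close>
  also have "\<dots> - ?h * \<theta>\<^sub>1\<^sup>2 = 0"
  proof -
    have m: "real m = (k - \<theta>\<^sub>2) / 2"
      using vieta(3) by simp
    show ?thesis
      unfolding s1 s2 v vieta(1,2) unfolding m by (simp add: power2_eq_square field_simps)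
  qed
  finally have "(\<Sum>y\<in>pverts G - H. (?n y - ?h / 2)\<^sup>2) = 0" .
  then have "(?n y - ?h / 2)\<^sup>2 = 0"
    using y fin sum_nonneg_eq_0_iff[of "pverts G - H" "\<lambda>y. (?n y - ?h / 2)\<^sup>2"] by simp
  then show ?thesis
    by simp
qed

theorem theorem1p1:
  fixes G :: "'a pair_pre_digraph"
    and xs :: "'a list"
    and H :: "'a set"
    and v k l m h :: nat
    and \<theta>\<^sub>1 \<theta>\<^sub>2 :: real
  assumes "strongly_regular G v k l m"
    and "primitive G"
    and "distinct xs" and "set xs = pverts G"
    and "{\<theta>. eigenvalue (adjacency_matrix G xs) \<theta>} = {real k, \<theta>\<^sub>1, \<theta>\<^sub>2}"
    and "real k > \<theta>\<^sub>1" and "\<theta>\<^sub>1 > \<theta>\<^sub>2"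
    and "H \<subseteq> pverts G" and "card H = h"
    and "real v = 2 * (real k - \<theta>\<^sub>1)"
  shows "strongly_regular (switching G H) v k l m \<longleftrightarrow>
         regular (with_proj G \<restriction> H) (real k - (real v - real h) / 2)"
proof -
  have pg: "pair_graph G" and deg: "\<And>x. x \<in> pverts G \<Longrightarrow> (\<Sum>y\<in>pverts G. adj G x y) = k"
    and card: "card (pverts G) = v"
    using assms(1) by (auto simp: strongly_regular_iff)
  note fin = finite_pverts[OF pg]
  have verts: "pverts (switching G H) = pverts G"
    by (simp add: switching_def)
  \<comment> \<open>The condition on \<open>v\<close> turns the prescribed degree into
    \<open>\<theta>\<^sub>1 + h / 2\<close>.\<close>
  have reg_iff: "regular (with_proj G \<restriction> H) (real k - (real v - real h) / 2) \<longleftrightarrow>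
      (\<forall>x\<in>H. (\<Sum>y\<in>H. adj G x y) = \<theta>\<^sub>1 + h / 2)"
    using assms(10) out_degree_induce[OF pg assms(8)]
    by (auto simp: regular_def field_simps)
  show ?thesis
  proof
    assume S: "strongly_regular (switching G H) v k l m"
    have "(\<Sum>y\<in>H. adj G x y) = \<theta>\<^sub>1 + h / 2" if "x \<in> H" for x
    proof -
      have "x \<in> pverts G"
        using that assms(8) by blast
      then show ?thesis
        using S degree_switching[OF fin assms(8), of x] deg[of x] that assms(9,10) card
        by (simp add: strongly_regular_iff verts)
    qed
    then show "regular (with_proj G \<restriction> H) (real k - (real v - real h) / 2)"
      using reg_iff by blast
  next
    assume "regular (with_proj G \<restriction> H) (real k - (real v - real h) / 2)"
    then have reg: "\<And>x. x \<in> H \<Longrightarrow> (\<Sum>y\<in>H. adj G x y) = \<theta>\<^sub>1 + card H / 2"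
      using reg_iff assms(9) by blast
    have q1: "\<theta>\<^sub>1\<^sup>2 = (real k - m) + (real l - m) * \<theta>\<^sub>1"
      and q2: "\<theta>\<^sub>2\<^sup>2 = (real k - m) + (real l - m) * \<theta>\<^sub>2"
      using assms(5-7) by (auto intro!: eigenvalue_quadratic[OF assms(1,3,4)])
    \<comment> \<open>Subtracting the two quadratic equations; as the roots differ, this gives their
      sum and then their product.\<close>
    then have "(\<theta>\<^sub>1 - \<theta>\<^sub>2) * (\<theta>\<^sub>1 + \<theta>\<^sub>2 - (real l - m)) = 0"
      by (simp add: power2_eq_square algebra_simps)
    then have vieta1: "real l - m = \<theta>\<^sub>1 + \<theta>\<^sub>2"
      using assms(7) by simp
    have vieta2: "real k - m = - \<theta>\<^sub>1 * \<theta>\<^sub>2"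
      using q1 unfolding vieta1 by (simp add: power2_eq_square algebra_simps)
    have "v \<noteq> 0"
      using assms(6,10) by auto
    then obtain x where x: "x \<in> pverts G"
      using card by fastforce
    \<comment> \<open>The identity for \<open>A^2\<close> applied to the all-ones vector. With
      \<open>v = 2 (k - \<theta>\<^sub>1)\<close> the factor \<open>k - \<theta>\<^sub>1\<close>
      splits off and can be cancelled.\<close>
    have "real k * k = (real k - m) + (real l - m) * k + real m * v"
      using sum_square_adj_apply[OF assms(1) x, of "\<lambda>_. 1"] x deg card
      by (simp add: sum_distrib_right[symmetric])
    then have "(k - \<theta>\<^sub>1) * (k - \<theta>\<^sub>2 - 2 * m) = 0"
      unfolding vieta1 vieta2 assms(10) by (simp add: algebra_simps)
    then have vieta3: "k - \<theta>\<^sub>2 = 2 * m"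
      using assms(6) by simp
    have nbr: "(\<Sum>y\<in>H. adj G x y) = \<theta>\<^sub>1 * of_bool (x \<in> H) + card H / 2" if "x \<in> pverts G" for x
      using neighbours_outside[OF assms(1,8,10) vieta1 vieta2 vieta3 reg, of x] reg[of x] that
      by (cases "x \<in> H") auto
    \<comment> \<open>For vertices on different sides the new count is
      \<open>k + \<theta>\<^sub>1\<close> minus the old one. By this equation it interchanges
      \<open>l\<close> and \<open>m\<close>, matching the complemented adjacency.\<close>
    have lm: "real l + m = k + \<theta>\<^sub>1"
      using vieta1 vieta3 by simp
    have card': "real (card (pverts G)) = 2 * (real k - \<theta>\<^sub>1)"
      using card assms(10) by simp
    show "strongly_regular (switching G H) v k l m"
      unfolding strongly_regular_iff verts
    proof (intro conjI ballI impI)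
      show "pair_graph (switching G H)"
        using pg by (rule pair_graph_switching)
      show "card (pverts G) = v"
        by (rule card)
      \<comment> \<open>The bracket in \<open>degree_switching\<close> becomes
        \<open>\<theta>\<^sub>1\<close> times the sign of \<open>x\<close>, so the degree is
        \<open>v / 2 + \<theta>\<^sub>1 = k\<close>.\<close>
      show "(\<Sum>y\<in>pverts G. adj (switching G H) x y) = k" if "x \<in> pverts G" for x
        unfolding degree_switching[OF fin assms(8) that] deg[OF that] nbr[OF that] card'
        by (auto simp: field_simps)
    next
      fix x y assume xy: "x \<in> pverts G" "y \<in> pverts G" "x \<noteq> y"
      then have sq: "(\<Sum>z\<in>pverts G. adj G x z * adj G y z) = (real l - m) * adj G x y + m"
        using assms(1) by (simp add: strongly_regular_iff)
      have *: "(\<Sum>z\<in>pverts G. adj (switching G H) x z * adj (switching G H) y z) =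
          card (pverts G) / 4 + \<theta>\<^sub>1 + (1 - 2 * of_bool (x \<in> H)) * (1 - 2 * of_bool (y \<in> H)) *
            (((real l - m) * adj G x y + m) - k + card (pverts G) / 4)"
        unfolding sq[symmetric]
        by (rule common_neighbours_switching[OF fin assms(8) xy(1,2)]) (use deg nbr card' in auto)
      show "(\<Sum>z\<in>pverts G. adj (switching G H) x z * adj (switching G H) y z) =
          (real l - m) * adj (switching G H) x y + m"
        using lm unfolding * adj_switching[OF xy(1,2)] card'
        by (cases "x \<in> H"; cases "y \<in> H") (simp_all add: field_simps)
    qed
  qed
qed

end
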